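(* Let $n$ be a positive integer with prime decomposition $n=p_1^{e_1}\cdots p_k^{e_k}$, with $k, e_1,\dots,e_k$ positive integers, and let $h\in\Lambda_n$ be a polynomial in $T$ whose leading and constant coefficients are invertible in $\mathbb{Z}_n$. Then, as quandles, $\Lambda_n/(h)$ is isomorphic to $$\Lambda_{p_1^{e_1}}/(h_1)\times\cdots\times\Lambda_{p_k^{e_k}}/(h_k),$$ where $h_j\equiv h \bmod p_j^{e_j}$, and each factor is inductively described as an Alexander extension: for each $j$ and each integer $d_j$ with $2\le d_j\le e_j$, writing $h_j$ also for its reduction modulo $p_j^{d_j}$, there is $\phi\in Z^2_{\rm TQ}\big(\Lambda_{p_j^{d_j-1}}/(\bar h_j);\,\Lambda_{p_j}/(\tilde h_j)\big)$ such that, as quandles, $$\Lambda_{p_j^{d_j}}/(h_j)\;\cong\; AE\big(\Lambda_{p_j^{d_j-1}}/(\bar h_j),\ \Lambda_{p_j}/(\tilde h_j),\ \phi\big),$$ where $\bar h_j\equiv h_j \bmod p_j^{d_j-1}$ and $\tilde h_j\equiv h_j\bmod p_j$.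
   Context: A quandle is a set $X$ with a binary operation $*$ such that (I) $a*a=a$; (II) for all $a,b$ there is a unique $c$ with $a=c*b$; (III) $(a*b)*c=(a*c)*(b*c)$. Let $\Lambda=\mathbb{Z}[T,T^{-1}]$ and, for a positive integer $q$, $\Lambda_q=\mathbb{Z}_q[T,T^{-1}]$ with $\mathbb{Z}_q=\mathbb{Z}/q\mathbb{Z}$. An Alexander quandle is a $\Lambda$-module $M$ with operation $a*b=Ta+(1-T)b$; each quotient $\Lambda_q/(h)$ is regarded as an Alexander quandle. Products of quandles carry the componentwise operation. For a quandle $X$ and a $\Lambda$-module $A$, $Z^2_{\rm TQ}(X;A)$ is the set of functions $\phi:X\times X\to A$ with $\phi(x,x)=0$ for all $x$ and $$T\phi(x_1,x_2)+\phi(x_1*x_2,x_3)=T\phi(x_1,x_3)+(1-T)\phi(x_2,x_3)+\phi(x_1*x_3,x_2*x_3)$$ for all $x_1,x_2,x_3\in X$. For such $\phi$, the Alexander extension $AE(X,A,\phi)$ is the quandle on the set $A\times X$ with $(a_1,x_1)*(a_2,x_2)=(a_1*a_2+\phi(x_1,x_2),\,x_1*x_2)$. *)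

theory Defs
  imports "HOL-Algebra.Module" "HOL-Algebra.QuotRing" "HOL-Algebra.IntRing" "HOL-Number_Theory.Residues"
begin

section \<open>Quandles\<close>

record 'a quandle = "'a partial_object" +
  qop :: "['a, 'a] \<Rightarrow> 'a" (infixl \<open>\<triangleright>\<index>\<close> 70)

locale quandle =
  fixes X (structure)
  assumes op_closed: "\<lbrakk>a \<in> carrier X; b \<in> carrier X\<rbrakk> \<Longrightarrow> a \<triangleright> b \<in> carrier X"
    and op_idem: "a \<in> carrier X \<Longrightarrow> a \<triangleright> a = a"
    and op_right_divisible:
      "\<lbrakk>a \<in> carrier X; b \<in> carrier X\<rbrakk> \<Longrightarrow> \<exists>!c. c \<in> carrier X \<and> a = c \<triangleright> b"
    and op_self_distrib:
      "\<lbrakk>a \<in> carrier X; b \<in> carrier X; c \<in> carrier X\<rbrakk>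
        \<Longrightarrow> (a \<triangleright> b) \<triangleright> c = (a \<triangleright> c) \<triangleright> (b \<triangleright> c)"

definition quandle_isomorphic ::
    "('a, 'm) quandle_scheme \<Rightarrow> ('b, 'n) quandle_scheme \<Rightarrow> bool" (infix \<open>\<cong>\<^sub>Q\<close> 50)
  where "X \<cong>\<^sub>Q Y \<longleftrightarrow> quandle X \<and> quandle Y \<and>
    (\<exists>f. bij_betw f (carrier X) (carrier Y) \<and>
      (\<forall>a\<in>carrier X. \<forall>b\<in>carrier X. f (a \<triangleright>\<^bsub>X\<^esub> b) = f a \<triangleright>\<^bsub>Y\<^esub> f b))"

definition product_quandle :: "'i set \<Rightarrow> ('i \<Rightarrow> ('a, 'm) quandle_scheme) \<Rightarrow> ('i \<Rightarrow> 'a) quandle"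
  where "product_quandle I X =
    \<lparr>carrier = (\<Pi>\<^sub>E i\<in>I. carrier (X i)),
     qop = (\<lambda>a b. \<lambda>i\<in>I. a i \<triangleright>\<^bsub>X i\<^esub> b i)\<rparr>"


section \<open>Laurent polynomials\<close>

text \<open>A Laurent polynomial over \<open>R\<close> is its finitely supported coefficient function,
  \<open>f i\<close> being the coefficient of \<open>T\<close> to the power \<open>i\<close>.\<close>

definition laurent_ring :: "('a, 'm) ring_scheme \<Rightarrow> (int \<Rightarrow> 'a) ring"
  where "laurent_ring R =
    \<lparr>carrier = {f. (\<forall>i. f i \<in> carrier R) \<and> finite {i. f i \<noteq> \<zero>\<^bsub>R\<^esub>}},
     mult = (\<lambda>f g k. \<Oplus>\<^bsub>R\<^esub>i\<in>{i. f i \<noteq> \<zero>\<^bsub>R\<^esub>}. f i \<otimes>\<^bsub>R\<^esub> g (k - i)),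
     one = (\<lambda>i. if i = 0 then \<one>\<^bsub>R\<^esub> else \<zero>\<^bsub>R\<^esub>),
     zero = (\<lambda>i. \<zero>\<^bsub>R\<^esub>),
     add = (\<lambda>f g i. f i \<oplus>\<^bsub>R\<^esub> g i)\<rparr>"

definition laurent_T :: "('a, 'm) ring_scheme \<Rightarrow> int \<Rightarrow> 'a"
  where "laurent_T R = (\<lambda>i. if i = 1 then \<one>\<^bsub>R\<^esub> else \<zero>\<^bsub>R\<^esub>)"

text \<open>The elements of \<open>laurent_ring R\<close> that are polynomials in \<open>T\<close>, that is, without negative
  powers of \<open>T\<close>. The leading coefficient is meaningful for nonzero elements only.\<close>

definition laurent_polys :: "('a, 'm) ring_scheme \<Rightarrow> (int \<Rightarrow> 'a) set"
  where "laurent_polys R = {f \<in> carrier (laurent_ring R). \<forall>i<0. f i = \<zero>\<^bsub>R\<^esub>}"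

definition laurent_lead_coeff :: "('a, 'm) ring_scheme \<Rightarrow> (int \<Rightarrow> 'a) \<Rightarrow> 'a"
  where "laurent_lead_coeff R f = f (Max {i. f i \<noteq> \<zero>\<^bsub>R\<^esub>})"

abbreviation Lambda :: "(int \<Rightarrow> int) ring" (\<open>\<Lambda>\<close>)
  where "\<Lambda> \<equiv> laurent_ring \<Z>"

text \<open>\<open>residue_ring q\<close>, with carrier \<open>{0..q - 1}\<close>, is the ring of integers modulo \<open>q\<close> for
  \<open>q \<ge> 2\<close> only, which covers all moduli used below.\<close>

abbreviation Lambda_mod :: "nat \<Rightarrow> (int \<Rightarrow> int) ring" (\<open>\<Lambda>\<^bsub>_\<^esub>\<close>)
  where "\<Lambda>\<^bsub>q\<^esub> \<equiv> laurent_ring (residue_ring (int q))"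

text \<open>Coefficientwise reduction modulo \<open>q\<close>. It serves as the map from \<open>\<Lambda>\<close> to \<open>\<Lambda>\<^bsub>q\<^esub>\<close>, and also
  as the map from \<open>\<Lambda>\<^bsub>m\<^esub>\<close> to \<open>\<Lambda>\<^bsub>q\<^esub>\<close> when \<open>q\<close> divides \<open>m\<close>.\<close>

definition laurent_reduce :: "nat \<Rightarrow> (int \<Rightarrow> int) \<Rightarrow> (int \<Rightarrow> int)"
  where "laurent_reduce q f = (\<lambda>i. f i mod int q)"

text \<open>The quotient ring of \<open>\<Lambda>\<^bsub>q\<^esub>\<close> by the ideal generated by \<open>h\<close>, on which \<open>\<Lambda>\<close> acts through
  the canonical ring homomorphism from \<open>\<Lambda>\<close> to that quotient.\<close>

definition Lambda_quot :: "nat \<Rightarrow> (int \<Rightarrow> int) \<Rightarrow> (int \<Rightarrow> int, (int \<Rightarrow> int) set) module"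
  where "Lambda_quot q h =
    (let I = PIdl\<^bsub>\<Lambda>\<^bsub>q\<^esub>\<^esub> h; Q = \<Lambda>\<^bsub>q\<^esub> Quot I
     in ring.extend Q (module.fields
          (\<lambda>c x. (I +>\<^bsub>\<Lambda>\<^bsub>q\<^esub>\<^esub> laurent_reduce q c) \<otimes>\<^bsub>Q\<^esub> x)))"


section \<open>Alexander quandles and Alexander extensions\<close>

abbreviation T_act :: "(int \<Rightarrow> int, 'b, 'm) module_scheme \<Rightarrow> 'b \<Rightarrow> 'b"
  where "T_act M a \<equiv> laurent_T \<Z> \<odot>\<^bsub>M\<^esub> a"

abbreviation one_minus_T_act :: "(int \<Rightarrow> int, 'b, 'm) module_scheme \<Rightarrow> 'b \<Rightarrow> 'b"
  where "one_minus_T_act M a \<equiv> (\<one>\<^bsub>\<Lambda>\<^esub> \<ominus>\<^bsub>\<Lambda>\<^esub> laurent_T \<Z>) \<odot>\<^bsub>M\<^esub> a"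

definition alexander_quandle :: "(int \<Rightarrow> int, 'b, 'm) module_scheme \<Rightarrow> 'b quandle"
  where "alexander_quandle M =
    \<lparr>carrier = carrier M, qop = (\<lambda>a b. T_act M a \<oplus>\<^bsub>M\<^esub> one_minus_T_act M b)\<rparr>"

definition Z2_TQ ::
    "('x, 'n) quandle_scheme \<Rightarrow> (int \<Rightarrow> int, 'b, 'm) module_scheme \<Rightarrow> ('x \<times> 'x \<Rightarrow> 'b) set"
  where "Z2_TQ X A =
    {\<phi> \<in> carrier X \<times> carrier X \<rightarrow>\<^sub>E carrier A.
      (\<forall>x\<in>carrier X. \<phi> (x, x) = \<zero>\<^bsub>A\<^esub>) \<and>
      (\<forall>x\<^sub>1\<in>carrier X. \<forall>x\<^sub>2\<in>carrier X. \<forall>x\<^sub>3\<in>carrier X.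
        T_act A (\<phi> (x\<^sub>1, x\<^sub>2)) \<oplus>\<^bsub>A\<^esub> \<phi> (x\<^sub>1 \<triangleright>\<^bsub>X\<^esub> x\<^sub>2, x\<^sub>3) =
        T_act A (\<phi> (x\<^sub>1, x\<^sub>3)) \<oplus>\<^bsub>A\<^esub> one_minus_T_act A (\<phi> (x\<^sub>2, x\<^sub>3))
          \<oplus>\<^bsub>A\<^esub> \<phi> (x\<^sub>1 \<triangleright>\<^bsub>X\<^esub> x\<^sub>3, x\<^sub>2 \<triangleright>\<^bsub>X\<^esub> x\<^sub>3))}"

definition alexander_extension ::
    "('x, 'n) quandle_scheme \<Rightarrow> (int \<Rightarrow> int, 'b, 'm) module_scheme \<Rightarrow> ('x \<times> 'x \<Rightarrow> 'b)
      \<Rightarrow> ('b \<times> 'x) quandle"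
  where "alexander_extension X A \<phi> =
    \<lparr>carrier = carrier A \<times> carrier X,
     qop = (\<lambda>(a\<^sub>1, x\<^sub>1) (a\<^sub>2, x\<^sub>2).
       ((a\<^sub>1 \<triangleright>\<^bsub>alexander_quandle A\<^esub> a\<^sub>2) \<oplus>\<^bsub>A\<^esub> \<phi> (x\<^sub>1, x\<^sub>2), x\<^sub>1 \<triangleright>\<^bsub>X\<^esub> x\<^sub>2))\<rparr>"

end

theory Submission
  imports Defs "HOL-Library.Poly_Mapping"
begin

text \<open>
  Every module \<open>\<Lambda>\<^bsub>q\<^esub>/(h)\<close> is a cyclic \<open>\<Lambda>\<close>-module: after choosing an integral lift \<open>H\<close> of \<open>h\<close>, it
  is the quotient of \<open>\<int>[T, T\<^sup>-\<^sup>1]\<close> by the ideal \<open>(q, H)\<close> (\<open>cyclic_Lambda_quot\<close>,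
  \<open>quot_map_eq_iff\<close>). All moduli in the theorem use the same lift \<open>H\<close>, so both
  assertions become statements about ideals of \<open>\<int>[T, T\<^sup>-\<^sup>1]\<close>.

  The product decomposition is the Chinese remainder theorem: \<open>(n, H)\<close> is the intersection of
  the ideals \<open>(q\<^sub>j, H)\<close> for pairwise coprime \<open>q\<^sub>j\<close> with product \<open>n\<close>, and a family of residues
  has a common representative (\<open>Lambda_quot_product\<close>).

  For the extensions, multiplication by \<open>m\<close> induces an exact sequence of \<open>\<Lambda>\<close>-modules
  \<open>0 \<rightarrow> \<Lambda>/(l, H) \<rightarrow> \<Lambda>/(m l, H) \<rightarrow> \<Lambda>/(m, H) \<rightarrow> 0\<close>. Injectivity on the left holds because the
  constant term of the polynomial \<open>H\<close> is invertible modulo \<open>m\<close>, which makes \<open>H\<close> cancellable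
  modulo \<open>m\<close> (\<open>coprime_const_coeff_dvd_mult_cancel\<close>). For any such sequence
  \<open>0 \<rightarrow> A \<rightarrow> D \<rightarrow> B \<rightarrow> 0\<close> and any set-theoretic section \<open>s\<close> of \<open>D \<rightarrow> B\<close>, the defect
  \<open>s b * s c - s (b * c)\<close> lies in the image of \<open>A\<close> and defines a cocycle \<open>\<phi>\<close>; sending \<open>x\<close> to the pair
  of \<open>x - s b\<close>, read in \<open>A\<close>, and \<open>b\<close>, where \<open>b\<close> is the image of \<open>x\<close> in \<open>B\<close>, identifies \<open>D\<close> with the
  Alexander extension (\<open>alexander_extension_of_exact\<close>). The case \<open>m = p\<^bsup>d - 1\<^esup>\<close>, \<open>l = p\<close> is the
  one required.
\<close>

section \<open>Integral Laurent polynomials\<close>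

text \<open>Integral Laurent polynomials as a type. The convolution product makes it an integral
  domain, so that calculations take place in type-class algebra.\<close>

type_synonym laurent = "int \<Rightarrow>\<^sub>0 int"

abbreviation lookup :: "('a \<Rightarrow>\<^sub>0 'b::zero) \<Rightarrow> 'a \<Rightarrow> 'b"
  where "lookup \<equiv> Poly_Mapping.lookup"

abbreviation keys :: "('a \<Rightarrow>\<^sub>0 'b::zero) \<Rightarrow> 'a set"
  where "keys \<equiv> Poly_Mapping.keys"

text \<open>The same ring as a structure with explicit carrier, the common source of the ring
  homomorphisms to the coefficient-function rings.\<close>

definition laurent_type_ring :: "laurent ring" (\<open>\<L>\<close>)
  where "\<L> = \<lparr>carrier = UNIV, mult = (*), one = 1, zero = 0, add = (+)\<rparr>"

lemma cring_laurent_type_ring: "cring \<L>"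
proof (rule cringI)
  show "abelian_group \<L>"
    by (rule abelian_groupI) (auto simp: laurent_type_ring_def intro: left_minus)
  show "Group.comm_monoid \<L>"
    by (rule comm_monoidI) (auto simp: laurent_type_ring_def algebra_simps)
qed (auto simp: laurent_type_ring_def algebra_simps)

text \<open>Coefficientwise application of \<open>\<rho>\<close>.\<close>

definition laurent_map :: "(int \<Rightarrow> 'a) \<Rightarrow> laurent \<Rightarrow> int \<Rightarrow> 'a"
  where "laurent_map \<rho> f = (\<lambda>i. \<rho> (lookup f i))"

lemma lookup_times_int:
  "lookup (f * g :: laurent) k = (\<Sum>i\<in>keys f. lookup f i * lookup g (k - i))"
proof -
  have "Sum_any (\<lambda>j. lookup g j when k = i + j) = lookup g (k - i)" for i
  proof -
    have "(\<lambda>j. lookup g j when k = i + j) = (\<lambda>j. lookup g j when j = k - i)"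
      by (auto simp: fun_eq_iff when_def)
    then show ?thesis by (simp only: Sum_any_when_equal)
  qed
  then have "lookup (f * g) k = Sum_any (\<lambda>i. lookup f i * lookup g (k - i))"
    by (simp add: lookup_mult)
  also have "\<dots> = (\<Sum>i\<in>keys f. lookup f i * lookup g (k - i))"
    by (rule Sum_any.expand_superset) (auto simp: in_keys_iff)
  finally show ?thesis .
qed

lemma lookup_of_nat_times: "lookup (of_nat q * f :: laurent) i = int q * lookup f i"
  by (induction q) (simp_all add: algebra_simps lookup_add)

lemma of_nat_dvd_laurent_iff:
  "of_nat q dvd (f :: laurent) \<longleftrightarrow> (\<forall>i. int q dvd lookup f i)"
proof
  assume "of_nat q dvd f"
  then show "\<forall>i. int q dvd lookup f i"
    by (auto simp: lookup_of_nat_times)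
next
  assume *: "\<forall>i. int q dvd lookup f i"
  have "finite {i. lookup f i div int q \<noteq> 0}"
    by (rule finite_subset[OF _ finite_keys[of f]]) (auto simp: in_keys_iff)
  then have "f = of_nat q * Abs_poly_mapping (\<lambda>i. lookup f i div int q)"
    using * by (intro poly_mapping_eqI) (simp add: lookup_of_nat_times)
  then show "of_nat q dvd f"
    by (rule dvdI)
qed

text \<open>The ring axioms for \<open>\<Lambda>\<close> and \<open>\<Lambda>\<^bsub>q\<^esub>\<close> are inherited along surjective homomorphisms from
  \<open>\<L>\<close>, so none of them has to be verified for the convolution product of coefficient functions.\<close>

lemma (in cring) image_cring:
  assumes hom: "h \<in> ring_hom R S" and surj: "h ` carrier R = carrier S" and zero: "h \<zero> = \<zero>\<^bsub>S\<^esub>"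
  shows "cring S"
proof -
  have "ring (S \<lparr>carrier := h ` carrier R, zero := h \<zero>\<rparr>)"
    by (rule ring_hom_imp_img_ring[OF hom])
  then interpret S: ring S
    by (simp add: surj zero)
  show ?thesis
  proof unfold_locales
    fix x y assume "x \<in> carrier S" "y \<in> carrier S"
    then obtain a b where "a \<in> carrier R" "b \<in> carrier R" "x = h a" "y = h b"
      by (auto simp flip: surj)
    then show "x \<otimes>\<^bsub>S\<^esub> y = y \<otimes>\<^bsub>S\<^esub> x"
      by (simp add: m_comm flip: ring_hom_mult[OF hom])
  qed
qed

lemma laurent_map_ring_hom:
  assumes "cring R" and "\<rho> \<in> ring_hom \<Z> R"
  shows "laurent_map \<rho> \<in> ring_hom \<L> (laurent_ring R)"
proof -
  interpret \<rho>: ring_hom_cring \<Z> R \<rho>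
    by (rule ring_hom_cringI) (use assms int_is_cring in auto)
  have \<rho>_simps [simp]: "\<rho> 0 = \<zero>\<^bsub>R\<^esub>" "\<rho> 1 = \<one>\<^bsub>R\<^esub>" "\<rho> x \<in> carrier R" 
      "\<rho> (x + y) = \<rho> x \<oplus>\<^bsub>R\<^esub> \<rho> y" "\<rho> (x * y) = \<rho> x \<otimes>\<^bsub>R\<^esub> \<rho> y" for x y
    using \<rho>.hom_zero \<rho>.hom_one \<rho>.hom_closed[of x] \<rho>.hom_add[of x y] \<rho>.hom_mult[of x y] by auto
  have supp: "{i. \<rho> (lookup f i) \<noteq> \<zero>\<^bsub>R\<^esub>} \<subseteq> keys f" for f :: laurent
  proof
    fix i assume "i \<in> {i. \<rho> (lookup f i) \<noteq> \<zero>\<^bsub>R\<^esub>}"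
    then have "lookup f i \<noteq> 0"
      using \<rho>_simps(1) by force
    then show "i \<in> keys f"
      by (simp add: in_keys_iff)
  qed
  have "laurent_map \<rho> (f * g) k =
      (\<Oplus>\<^bsub>R\<^esub>i\<in>{i. \<rho> (lookup f i) \<noteq> \<zero>\<^bsub>R\<^esub>}. \<rho> (lookup f i) \<otimes>\<^bsub>R\<^esub> \<rho> (lookup g (k - i)))" for f g k
  proof -
    have "laurent_map \<rho> (f * g) k = \<rho> (\<Sum>i\<in>keys f. lookup f i * lookup g (k - i))"
      by (simp add: laurent_map_def lookup_times_int)
    also have "\<dots> = (\<Oplus>\<^bsub>R\<^esub>i\<in>keys f. \<rho> (lookup f i) \<otimes>\<^bsub>R\<^esub> \<rho> (lookup g (k - i)))"
      by (subst \<rho>.hom_finsum) (auto simp: o_def)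
    \<comment> \<open>Coefficients in the kernel of \<open>\<rho>\<close> leave the support but contribute zero.\<close>
    also have "\<dots> = (\<Oplus>\<^bsub>R\<^esub>i\<in>{i. \<rho> (lookup f i) \<noteq> \<zero>\<^bsub>R\<^esub>}. \<rho> (lookup f i) \<otimes>\<^bsub>R\<^esub> \<rho> (lookup g (k - i)))"
      by (rule \<rho>.S.add.finprod_mono_neutral_cong_right) (auto simp: supp)
    finally show ?thesis .
  qed
  moreover have "finite {i. \<rho> (lookup f i) \<noteq> \<zero>\<^bsub>R\<^esub>}" for f :: laurent
    by (rule finite_subset[OF supp finite_keys])
  ultimately show ?thesis
    by (intro ring_hom_memI)
       (auto simp: laurent_type_ring_def laurent_ring_def laurent_map_def fun_eq_iff
          lookup_add lookup_one when_def)
qed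

lemma laurent_hom_diff:
  assumes "cring S" and hom: "h \<in> ring_hom \<L> S"
  shows "h (x - y) = h x \<ominus>\<^bsub>S\<^esub> h y"
proof -
  interpret S: cring S by fact
  have closed: "h z \<in> carrier S" for z
    using ring_hom_closed[OF hom, of z] by (simp add: laurent_type_ring_def)
  have "h x = h (x - y) \<oplus>\<^bsub>S\<^esub> h y"
    using ring_hom_add[OF hom, of "x - y" y] by (simp add: laurent_type_ring_def)
  then show ?thesis
    by (simp add: closed S.minus_eq S.a_assoc S.r_neg)
qed

abbreviation \<T> :: laurent
  where "\<T> \<equiv> Poly_Mapping.single 1 1"

abbreviation inv\<T> :: laurent
  where "inv\<T> \<equiv> Poly_Mapping.single (-1) 1"

lemma inv\<T>_mult: "inv\<T> * \<T> = 1" "\<T> * inv\<T> = 1"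
  by (simp_all add: mult_single)

lemma lookup_hom: "lookup \<in> ring_hom \<L> \<Lambda>"
proof -
  have "(\<lambda>x. x) \<in> ring_hom \<Z> \<Z>"
    by (rule ring_hom_memI) auto
  from laurent_map_ring_hom[OF int_is_cring this] show ?thesis
    by (simp add: laurent_map_def[abs_def])
qed

lemma cring_Lambda: "cring \<Lambda>"
proof (rule cring.image_cring[OF cring_laurent_type_ring lookup_hom])
  have "f \<in> range lookup" if "finite {i. f i \<noteq> (0::int)}" for f :: "int \<Rightarrow> int"
    using that by (metis Abs_poly_mapping_inverse mem_Collect_eq rangeI)
  then show "lookup ` carrier \<L> = carrier \<Lambda>"
    by (auto simp: laurent_type_ring_def laurent_ring_def)
  show "lookup \<zero>\<^bsub>\<L>\<^esub> = \<zero>\<^bsub>\<Lambda>\<^esub>"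
    by (simp add: laurent_type_ring_def laurent_ring_def fun_eq_iff)
qed

lemma lookup_\<T>: "lookup \<T> = laurent_T \<Z>"
  by (auto simp: laurent_T_def lookup_single when_def fun_eq_iff)

lemma lookup_one_minus_\<T>: "lookup (1 - \<T>) = \<one>\<^bsub>\<Lambda>\<^esub> \<ominus>\<^bsub>\<Lambda>\<^esub> laurent_T \<Z>"
proof -
  have one: "lookup 1 = \<one>\<^bsub>\<Lambda>\<^esub>"
    by (auto simp: laurent_ring_def lookup_one when_def fun_eq_iff)
  show ?thesis
    by (rule laurent_hom_diff[OF cring_Lambda lookup_hom, of 1 \<T>, unfolded one lookup_\<T>])
qed

section \<open>Reduction modulo an integer\<close>

abbreviation reduce :: "nat \<Rightarrow> laurent \<Rightarrow> int \<Rightarrow> int"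
  where "reduce q f \<equiv> laurent_reduce q (lookup f)"

lemma reduce_eq_iff: "reduce q f = reduce q g \<longleftrightarrow> of_nat q dvd f - g"
  by (simp add: laurent_reduce_def of_nat_dvd_laurent_iff fun_eq_iff lookup_minus mod_eq_dvd_iff)

context
  fixes q :: nat
  assumes q: "1 < q"
begin

interpretation residues "int q" "residue_ring (int q)"
  by unfold_locales (use q in auto)

lemma reduce_hom: "reduce q \<in> ring_hom \<L> \<Lambda>\<^bsub>q\<^esub>"
proof -
  have "(\<lambda>x. x mod int q) \<in> ring_hom \<Z> (residue_ring (int q))"
    by (rule ring_hom_memI) (auto simp: add_cong mult_cong one_cong)
  from laurent_map_ring_hom[OF cring this] show ?thesis
    by (simp add: laurent_map_def[abs_def] laurent_reduce_def)
qed

lemma reduce_surj: "range (reduce q) = carrier \<Lambda>\<^bsub>q\<^esub>"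
proof
  show "range (reduce q) \<subseteq> carrier \<Lambda>\<^bsub>q\<^esub>"
    using ring_hom_closed[OF reduce_hom] by (auto simp: laurent_type_ring_def)
  show "carrier \<Lambda>\<^bsub>q\<^esub> \<subseteq> range (reduce q)"
  proof
    fix f assume "f \<in> carrier \<Lambda>\<^bsub>q\<^esub>"
    then have fin: "finite {i. f i \<noteq> 0}" and "f i \<in> {0..int q - 1}" for i
      by (auto simp: laurent_ring_def residue_ring_def)
    then have "f = reduce q (Abs_poly_mapping f)"
      by (auto simp: laurent_reduce_def fun_eq_iff)
    then show "f \<in> range (reduce q)" by blast
  qed
qed

lemma cring_Lambda_mod: "cring \<Lambda>\<^bsub>q\<^esub>"
proof (rule cring.image_cring[OF cring_laurent_type_ring reduce_hom])
  show "reduce q ` carrier \<L> = carrier \<Lambda>\<^bsub>q\<^esub>"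
    using reduce_surj by (simp add: laurent_type_ring_def)
  show "reduce q \<zero>\<^bsub>\<L>\<^esub> = \<zero>\<^bsub>\<Lambda>\<^bsub>q\<^esub>\<^esub>"
    by (simp add: laurent_type_ring_def laurent_ring_def laurent_reduce_def residue_ring_def fun_eq_iff)
qed

end

section \<open>Cyclic modules and their Alexander quandles\<close>

text \<open>A cyclic \<open>\<Lambda>\<close>-module, given by a surjective \<open>\<Lambda>\<close>-linear map \<open>\<pi>\<close> from the Laurent
  polynomials. No module axiom is assumed for \<open>M\<close>, since the map transports the laws that are
  needed.\<close>

locale cyclic_module =
  fixes M :: "(int \<Rightarrow> int, 'b, 'm) module_scheme" (structure) and \<pi> :: "laurent \<Rightarrow> 'b"
  assumes surj: "range \<pi> = carrier M"
    and zero: "\<pi> 0 = \<zero>"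
    and add: "\<pi> (x + y) = \<pi> x \<oplus> \<pi> y"
    and smult: "\<pi> (c * x) = lookup c \<odot> \<pi> x"
begin

lemma closed [simp]: "\<pi> x \<in> carrier M"
  using surj by auto

lemma cong_add: "\<pi> x = \<pi> x' \<Longrightarrow> \<pi> y = \<pi> y' \<Longrightarrow> \<pi> (x + y) = \<pi> (x' + y')"
  by (simp add: add)

lemma cong_mult: "\<pi> x = \<pi> x' \<Longrightarrow> \<pi> (c * x) = \<pi> (c * x')"
  by (simp add: smult)

lemma cong_diff: "\<pi> x = \<pi> x' \<Longrightarrow> \<pi> y = \<pi> y' \<Longrightarrow> \<pi> (x - y) = \<pi> (x' - y')"
  using cong_add[OF _ cong_mult[of y y' "-1"], of x x'] by simp

lemma eq_iff: "\<pi> x = \<pi> y \<longleftrightarrow> \<pi> (x - y) = \<pi> 0"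
  using cong_diff[of x y y y] cong_add[of "x - y" 0 y y] by auto

end

text \<open>The Alexander quandle operation on Laurent polynomials.\<close>

definition alexander_op :: "laurent \<Rightarrow> laurent \<Rightarrow> laurent" (infixl \<open>\<rhd>\<close> 70)
  where "x \<rhd> y = \<T> * x + (1 - \<T>) * y"

lemma carrier_alexander_quandle [simp]: "carrier (alexander_quandle M) = carrier M"
  by (simp add: alexander_quandle_def)

context cyclic_module
begin

lemma qop_eq: "\<pi> x \<triangleright>\<^bsub>alexander_quandle M\<^esub> \<pi> y = \<pi> (x \<rhd> y)"
  by (simp only: alexander_quandle_def alexander_op_def add smult quandle.simps
      lookup_\<T> lookup_one_minus_\<T>)

lemma cong_op: "\<pi> x = \<pi> x' \<Longrightarrow> \<pi> y = \<pi> y' \<Longrightarrow> \<pi> (x \<rhd> y) = \<pi> (x' \<rhd> y')"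
  unfolding alexander_op_def by (intro cong_add cong_mult)

lemma right_divisible: "\<pi> x = \<pi> (z \<rhd> y) \<longleftrightarrow> \<pi> z = \<pi> (inv\<T> * (x - (1 - \<T>) * y))"
proof
  assume "\<pi> x = \<pi> (z \<rhd> y)"
  then have "\<pi> (inv\<T> * (x - (1 - \<T>) * y)) = \<pi> (inv\<T> * (z \<rhd> y - (1 - \<T>) * y))"
    by (intro cong_mult cong_diff) auto
  also have "inv\<T> * (z \<rhd> y - (1 - \<T>) * y) = (inv\<T> * \<T>) * z"
    by (simp only: alexander_op_def algebra_simps)
  finally show "\<pi> z = \<pi> (inv\<T> * (x - (1 - \<T>) * y))"
    by (simp only: inv\<T>_mult mult_1_left)
next
  assume "\<pi> z = \<pi> (inv\<T> * (x - (1 - \<T>) * y))"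
  then have "\<pi> (z \<rhd> y) = \<pi> ((inv\<T> * (x - (1 - \<T>) * y)) \<rhd> y)"
    by (rule cong_op) simp
  also have "(inv\<T> * (x - (1 - \<T>) * y)) \<rhd> y
      = (\<T> * inv\<T>) * (x - (1 - \<T>) * y) + (1 - \<T>) * y"
    by (simp only: alexander_op_def algebra_simps)
  finally show "\<pi> x = \<pi> (z \<rhd> y)"
    by (simp only: inv\<T>_mult mult_1_left diff_add_cancel)
qed

lemma quandle_alexander: "quandle (alexander_quandle M)"
proof
  fix a b c
  assume "a \<in> carrier (alexander_quandle M)" "b \<in> carrier (alexander_quandle M)"
  then obtain x y where [simp]: "a = \<pi> x" "b = \<pi> y"
    by (auto simp flip: surj)
  show "a \<triangleright>\<^bsub>alexander_quandle M\<^esub> b \<in> carrier (alexander_quandle M)"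
    by (simp add: qop_eq)
  show "\<exists>!c. c \<in> carrier (alexander_quandle M) \<and> a = c \<triangleright>\<^bsub>alexander_quandle M\<^esub> b"
  proof (rule ex1I)
    let ?z = "inv\<T> * (x - (1 - \<T>) * y)"
    have "\<pi> x = \<pi> (?z \<rhd> y)" by (simp only: right_divisible)
    then show "\<pi> ?z \<in> carrier (alexander_quandle M) \<and> a = \<pi> ?z \<triangleright>\<^bsub>alexander_quandle M\<^esub> b"
      by (simp add: qop_eq)
    fix c assume "c \<in> carrier (alexander_quandle M) \<and> a = c \<triangleright>\<^bsub>alexander_quandle M\<^esub> b"
    moreover then obtain z where "c = \<pi> z" by (auto simp flip: surj)
    ultimately show "c = \<pi> ?z"
      by (simp add: qop_eq right_divisible)
  qed
  assume "c \<in> carrier (alexander_quandle M)"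
  then obtain z where [simp]: "c = \<pi> z"
    by (auto simp flip: surj)
  have "x \<rhd> y \<rhd> z = (x \<rhd> z) \<rhd> (y \<rhd> z)"
    by (simp add: alexander_op_def algebra_simps)
  then show "a \<triangleright>\<^bsub>alexander_quandle M\<^esub> b \<triangleright>\<^bsub>alexander_quandle M\<^esub> c
      = a \<triangleright>\<^bsub>alexander_quandle M\<^esub> c \<triangleright>\<^bsub>alexander_quandle M\<^esub> (b \<triangleright>\<^bsub>alexander_quandle M\<^esub> c)"
    by (simp add: qop_eq)
next
  fix a assume "a \<in> carrier (alexander_quandle M)"
  then obtain x where [simp]: "a = \<pi> x"
    by (auto simp flip: surj)
  have "x \<rhd> x = x"
    by (simp add: alexander_op_def algebra_simps)
  then show "a \<triangleright>\<^bsub>alexander_quandle M\<^esub> a = a"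
    by (simp add: qop_eq)
qed

end

text \<open>Only the source has to be known to be a quandle: the axioms are transported along the
  bijection.\<close>

lemma quandle_isomorphicI:
  assumes X: "quandle X" and f: "bij_betw f (carrier X) (carrier Y)"
    and hom: "\<And>a b. a \<in> carrier X \<Longrightarrow> b \<in> carrier X \<Longrightarrow>
      f (a \<triangleright>\<^bsub>X\<^esub> b) = f a \<triangleright>\<^bsub>Y\<^esub> f b"
  shows "X \<cong>\<^sub>Q Y"
proof -
  interpret X: quandle X by fact
  have im: "carrier Y = f ` carrier X"
    using f by (simp add: bij_betw_def)
  have inj: "f a = f b \<longleftrightarrow> a = b" if "a \<in> carrier X" "b \<in> carrier X" for a b
    using f that by (auto simp: bij_betw_def inj_on_eq_iff)
  have "quandle Y"
  proof
    fix a b assume "a \<in> carrier Y" "b \<in> carrier Y"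
    then obtain x y where x: "x \<in> carrier X" "a = f x" and y: "y \<in> carrier X" "b = f y"
      by (auto simp: im)
    then show "a \<triangleright>\<^bsub>Y\<^esub> b \<in> carrier Y"
      by (simp add: im X.op_closed flip: hom)
    from X.op_right_divisible[OF x(1) y(1)]
    obtain z where z: "z \<in> carrier X" "x = z \<triangleright>\<^bsub>X\<^esub> y"
      and uniq: "\<And>z'. z' \<in> carrier X \<Longrightarrow> x = z' \<triangleright>\<^bsub>X\<^esub> y \<Longrightarrow> z' = z"
      by blast
    show "\<exists>!c. c \<in> carrier Y \<and> a = c \<triangleright>\<^bsub>Y\<^esub> b"
    proof (rule ex1I)
      show "f z \<in> carrier Y \<and> a = f z \<triangleright>\<^bsub>Y\<^esub> b"
        using x y z by (simp add: im flip: hom)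
      fix c assume "c \<in> carrier Y \<and> a = c \<triangleright>\<^bsub>Y\<^esub> b"
      moreover then obtain w where "w \<in> carrier X" "c = f w" by (auto simp: im)
      ultimately show "c = f z"
        using x y uniq[of w] by (simp add: inj X.op_closed flip: hom)
    qed
    fix c assume "c \<in> carrier Y"
    then obtain z where z: "z \<in> carrier X" "c = f z"
      by (auto simp: im)
    show "a \<triangleright>\<^bsub>Y\<^esub> b \<triangleright>\<^bsub>Y\<^esub> c = a \<triangleright>\<^bsub>Y\<^esub> c \<triangleright>\<^bsub>Y\<^esub> (b \<triangleright>\<^bsub>Y\<^esub> c)"
      using arg_cong[OF X.op_self_distrib[OF x(1) y(1) z(1)], of f] x y z
      by (simp add: X.op_closed hom)
  next
    fix a assume "a \<in> carrier Y"
    then show "a \<triangleright>\<^bsub>Y\<^esub> a = a"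
      by (auto simp: im X.op_idem simp flip: hom)
  qed
  with X f hom show ?thesis
    unfolding quandle_isomorphic_def by blast
qed


section \<open>Products and extensions of cyclic modules\<close>

text \<open>If the kernel of \<open>\<pi>\<close> is the intersection of the kernels of the \<open>\<nu> i\<close> and every family
  of residues has a common representative, then \<open>M\<close> is the product of the \<open>N i\<close>.\<close>

lemma alexander_product:
  assumes M: "cyclic_module M \<pi>" and N: "\<And>i. i \<in> I \<Longrightarrow> cyclic_module (N i) (\<nu> i)"
    and ker: "\<And>x. \<pi> x = \<pi> 0 \<longleftrightarrow> (\<forall>i\<in>I. \<nu> i x = \<nu> i 0)"
    and approx: "\<And>y. \<exists>x. \<forall>i\<in>I. \<nu> i x = \<nu> i (y i)"
  shows "alexander_quandle M \<cong>\<^sub>Q product_quandle I (\<lambda>i. alexander_quandle (N i))"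
proof -
  interpret M: cyclic_module M \<pi> by fact
  have eq_iff: "\<pi> x = \<pi> y \<longleftrightarrow> (\<forall>i\<in>I. \<nu> i x = \<nu> i y)" for x y
    using M.eq_iff ker cyclic_module.eq_iff[OF N] by metis
  define f where "f m = (\<lambda>i\<in>I. \<nu> i (SOME x. \<pi> x = m))" for m
  have f: "f (\<pi> x) = (\<lambda>i\<in>I. \<nu> i x)" for x
  proof -
    have "\<pi> (SOME y. \<pi> y = \<pi> x) = \<pi> x"
      by (rule someI) simp
    then show ?thesis
      by (auto simp: f_def eq_iff)
  qed
  show ?thesis
  proof (rule quandle_isomorphicI[OF M.quandle_alexander])
    show "bij_betw f (carrier (alexander_quandle M))
        (carrier (product_quandle I (\<lambda>i. alexander_quandle (N i))))"
    proof (rule bij_betw_imageI)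
      show "inj_on f (carrier (alexander_quandle M))"
      proof (rule inj_onI)
        fix a b assume "a \<in> carrier (alexander_quandle M)" "b \<in> carrier (alexander_quandle M)"
          and *: "f a = f b"
        then obtain x y where xy: "a = \<pi> x" "b = \<pi> y"
          by (auto simp flip: M.surj)
        have "\<nu> i x = \<nu> i y" if "i \<in> I" for i
          using fun_cong[OF *, of i] that by (simp add: xy f)
        then show "a = b"
          by (simp add: xy eq_iff)
      qed
      have f_mem: "f (\<pi> x) \<in> (\<Pi>\<^sub>E i\<in>I. carrier (N i))" for x
        unfolding f by (simp add: cyclic_module.closed[OF N])
      moreover have "a \<in> f ` range \<pi>" if a: "a \<in> (\<Pi>\<^sub>E i\<in>I. carrier (N i))" for a
      proof -
        have "\<forall>i\<in>I. \<exists>x. a i = \<nu> i x"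
          using PiE_mem[OF a] cyclic_module.surj[OF N] by blast
        from bchoice[OF this] obtain x where x: "\<And>i. i \<in> I \<Longrightarrow> a i = \<nu> i (x i)"
          by blast
        moreover from approx[of x] obtain s where "\<forall>i\<in>I. \<nu> i s = \<nu> i (x i)"
          by blast
        ultimately have "\<nu> j s = a j" if "j \<in> I" for j
          using that by simp
        then have "a = f (\<pi> s)"
          unfolding f by (intro PiE_ext[OF a f_mem[unfolded f]]) simp
        then show ?thesis by blast
      qed
      ultimately show "f ` carrier (alexander_quandle M)
          = carrier (product_quandle I (\<lambda>i. alexander_quandle (N i)))"
        by (auto simp: product_quandle_def simp flip: M.surj)
    qed
    fix a b assume "a \<in> carrier (alexander_quandle M)" "b \<in> carrier (alexander_quandle M)"
    then obtain x y where xy: "a = \<pi> x" "b = \<pi> y"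
      by (auto simp flip: M.surj)
    show "f (a \<triangleright>\<^bsub>alexander_quandle M\<^esub> b)
        = f a \<triangleright>\<^bsub>product_quandle I (\<lambda>i. alexander_quandle (N i))\<^esub> f b"
      by (auto simp: xy M.qop_eq f product_quandle_def fun_eq_iff cyclic_module.qop_eq[OF N])
  qed
qed

text \<open>The two conditions on kernels say that multiplication by \<open>r\<close> induces an exact sequence
  \<open>0 \<rightarrow> A \<rightarrow> D \<rightarrow> B \<rightarrow> 0\<close>.\<close>

lemma alexander_extension_of_exact:
  assumes D: "cyclic_module D \<delta>" and B: "cyclic_module B \<beta>" and A: "cyclic_module A \<alpha>"
    and ker_\<beta>: "\<And>x. \<beta> x = \<beta> 0 \<longleftrightarrow> (\<exists>a. \<delta> x = \<delta> (r * a))"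
    and inj: "\<And>a. \<delta> (r * a) = \<delta> 0 \<longleftrightarrow> \<alpha> a = \<alpha> 0"
  shows "\<exists>\<phi>\<in>Z2_TQ (alexander_quandle B) A.
    alexander_quandle D \<cong>\<^sub>Q alexander_extension (alexander_quandle B) A \<phi>"
proof -
  interpret D: cyclic_module D \<delta> by fact
  interpret B: cyclic_module B \<beta> by fact
  interpret A: cyclic_module A \<alpha> by fact
  have cong: "\<alpha> a = \<alpha> b" if "\<delta> (r * a) = \<delta> (r * b)" for a b
    using that D.eq_iff[of "r * a" "r * b"] A.eq_iff[of a b] inj[of "a - b"]
    by (simp add: right_diff_distrib)
  have \<beta>_cong: "\<beta> x = \<beta> y" if "\<delta> x = \<delta> y" for x y
    using that D.eq_iff[of x y] B.eq_iff[of x y] ker_\<beta>[of "x - y"] by (metis mult_zero_right)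

  \<comment> \<open>\<open>\<theta>\<close> is the inverse of \<open>A \<rightarrow> D\<close> on the kernel of \<open>D \<rightarrow> B\<close>, precomposed with \<open>\<delta>\<close>.
    It is meaningful only where \<open>\<beta>\<close> vanishes.\<close>
  define \<theta> where "\<theta> z = \<alpha> (SOME a. \<delta> z = \<delta> (r * a))" for z
  have \<theta>_eqI: "\<theta> z = \<alpha> a" if "\<delta> z = \<delta> (r * a)" for z a
  proof -
    have "\<delta> z = \<delta> (r * (SOME a. \<delta> z = \<delta> (r * a)))"
      using that by (rule someI)
    with that show ?thesis
      unfolding \<theta>_def by (intro cong) simp
  qed
  have \<theta>_E: "\<exists>a. \<delta> z = \<delta> (r * a) \<and> \<theta> z = \<alpha> a" if "\<beta> z = \<beta> 0" for z
    using that ker_\<beta> \<theta>_eqI by blast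
  have \<theta>_closed: "\<theta> z \<in> carrier A" for z
    by (simp add: \<theta>_def)
  have \<theta>_zero: "\<theta> 0 = \<zero>\<^bsub>A\<^esub>"
    using \<theta>_eqI[of 0 0] by (simp add: A.zero)
  have \<theta>_add: "\<theta> (z + w) = \<theta> z \<oplus>\<^bsub>A\<^esub> \<theta> w" if z: "\<beta> z = \<beta> 0" and w: "\<beta> w = \<beta> 0" for z w
  proof -
    obtain a b
      where a: "\<delta> z = \<delta> (r * a)" "\<theta> z = \<alpha> a" and b: "\<delta> w = \<delta> (r * b)" "\<theta> w = \<alpha> b"
      using \<theta>_E[OF z] \<theta>_E[OF w] by blast
    have "\<delta> (z + w) = \<delta> (r * (a + b))"
      unfolding distrib_left by (rule D.cong_add[OF a(1) b(1)])
    then show ?thesis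
      using a b by (simp only: \<theta>_eqI A.add)
  qed
  have \<theta>_mult: "\<theta> (c * z) = lookup c \<odot>\<^bsub>A\<^esub> \<theta> z" if z: "\<beta> z = \<beta> 0" for c z
  proof -
    obtain a where a: "\<delta> z = \<delta> (r * a)" "\<theta> z = \<alpha> a"
      using \<theta>_E[OF z] by blast
    then have "\<delta> (c * z) = \<delta> (c * (r * a))"
      by (intro D.cong_mult)
    with a show ?thesis
      using \<theta>_eqI[of "c * z" "c * a"] by (simp only: mult.left_commute A.smult)
  qed
  have ker_add: "\<beta> (z + w) = \<beta> 0" if "\<beta> z = \<beta> 0" "\<beta> w = \<beta> 0" for z w
    using B.cong_add[OF that] by simp
  have ker_mult: "\<beta> (c * z) = \<beta> 0" if "\<beta> z = \<beta> 0" for c z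
    using B.cong_mult[OF that, of c] by simp
  have \<theta>_linear: "\<theta> (\<T> * z + (1 - \<T>) * w) =
      laurent_T \<Z> \<odot>\<^bsub>A\<^esub> \<theta> z \<oplus>\<^bsub>A\<^esub> (\<one>\<^bsub>\<Lambda>\<^esub> \<ominus>\<^bsub>\<Lambda>\<^esub> laurent_T \<Z>) \<odot>\<^bsub>A\<^esub> \<theta> w"
    if "\<beta> z = \<beta> 0" "\<beta> w = \<beta> 0" for z w
    using that by (simp only: \<theta>_add ker_mult \<theta>_mult lookup_\<T> lookup_one_minus_\<T>)
  have \<theta>_cong: "\<theta> z = \<theta> w" if "\<delta> z = \<delta> w" "\<beta> z = \<beta> 0" for z w
    using \<theta>_E[OF that(2)] \<theta>_eqI[of w] that(1) by auto

  \<comment> \<open>A section of \<open>\<beta>\<close>, with no compatibility required.\<close>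
  define s where "s b = (SOME x. \<beta> x = b)" for b
  have \<beta>_s: "\<beta> (s (\<beta> x)) = \<beta> x" for x
    unfolding s_def by (rule someI) simp
  have ker_diff: "\<beta> (x - y) = \<beta> 0" if "\<beta> x = \<beta> y" for x y
    using that B.eq_iff by blast

  let ?B = "alexander_quandle B"
  \<comment> \<open>The failure of the section to be a quandle homomorphism; its image under \<open>\<theta>\<close> is the
    cocycle.\<close>
  define \<epsilon> where "\<epsilon> b c = s b \<rhd> s c - s (b \<triangleright>\<^bsub>?B\<^esub> c)" for b c
  have ker_\<epsilon>: "\<beta> (\<epsilon> b c) = \<beta> 0" if "b \<in> carrier B" "c \<in> carrier B" for b c
  proof -
    from that obtain x y where bc: "b = \<beta> x" "c = \<beta> y"
      by (auto simp flip: B.surj)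
    show ?thesis
      unfolding \<epsilon>_def bc B.qop_eq by (intro ker_diff) (simp only: \<beta>_s, intro B.cong_op \<beta>_s)
  qed
  interpret QB: quandle ?B by (rule B.quandle_alexander)
  define \<phi> where "\<phi> = restrict (\<lambda>(b, c). \<theta> (\<epsilon> b c)) (carrier ?B \<times> carrier ?B)"
  have \<phi>: "\<phi> (b, c) = \<theta> (\<epsilon> b c)" if "b \<in> carrier ?B" "c \<in> carrier ?B" for b c
    using that by (simp add: \<phi>_def)
  have "\<phi> \<in> Z2_TQ ?B A"
    unfolding Z2_TQ_def
  proof (intro CollectI conjI ballI)
    show "\<phi> \<in> carrier ?B \<times> carrier ?B \<rightarrow>\<^sub>E carrier A"
      by (auto simp: \<phi>_def \<theta>_closed)
  next
    fix b assume b: "b \<in> carrier ?B"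
    then have "\<epsilon> b b = 0"
      by (simp add: \<epsilon>_def QB.op_idem alexander_op_def algebra_simps)
    with b show "\<phi> (b, b) = \<zero>\<^bsub>A\<^esub>"
      by (simp add: \<phi>_def \<theta>_zero)
  next
    fix b1 b2 b3 assume b: "b1 \<in> carrier ?B" "b2 \<in> carrier ?B" "b3 \<in> carrier ?B"
    note b' = QB.op_closed[OF b(1,2)] QB.op_closed[OF b(1,3)] QB.op_closed[OF b(2,3)]
    \<comment> \<open>The cocycle identity already holds for Laurent polynomials: both sides equal
      \<open>s b1 \<rhd> s b2 \<rhd> s b3 - s (b1 * b2 * b3)\<close>, by self-distributivity of \<open>\<rhd>\<close> and of \<open>B\<close>.\<close>
    have "\<T> * \<epsilon> b1 b2 + \<epsilon> (b1 \<triangleright>\<^bsub>?B\<^esub> b2) b3 =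
        \<T> * \<epsilon> b1 b3 + (1 - \<T>) * \<epsilon> b2 b3 + \<epsilon> (b1 \<triangleright>\<^bsub>?B\<^esub> b3) (b2 \<triangleright>\<^bsub>?B\<^esub> b3)"
      unfolding \<epsilon>_def QB.op_self_distrib[OF b, symmetric]
      by (simp only: alexander_op_def algebra_simps mult_1_left)
    then have "\<theta> (\<T> * \<epsilon> b1 b2) \<oplus>\<^bsub>A\<^esub> \<theta> (\<epsilon> (b1 \<triangleright>\<^bsub>?B\<^esub> b2) b3) =
        \<theta> (\<T> * \<epsilon> b1 b3 + (1 - \<T>) * \<epsilon> b2 b3)
          \<oplus>\<^bsub>A\<^esub> \<theta> (\<epsilon> (b1 \<triangleright>\<^bsub>?B\<^esub> b3) (b2 \<triangleright>\<^bsub>?B\<^esub> b3))"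
      using b b' by (subst (1 2) \<theta>_add[symmetric]) (auto intro!: ker_\<epsilon> ker_mult ker_add)
    then have "laurent_T \<Z> \<odot>\<^bsub>A\<^esub> \<theta> (\<epsilon> b1 b2) \<oplus>\<^bsub>A\<^esub> \<theta> (\<epsilon> (b1 \<triangleright>\<^bsub>?B\<^esub> b2) b3) =
        (laurent_T \<Z> \<odot>\<^bsub>A\<^esub> \<theta> (\<epsilon> b1 b3)
          \<oplus>\<^bsub>A\<^esub> (\<one>\<^bsub>\<Lambda>\<^esub> \<ominus>\<^bsub>\<Lambda>\<^esub> laurent_T \<Z>) \<odot>\<^bsub>A\<^esub> \<theta> (\<epsilon> b2 b3))
        \<oplus>\<^bsub>A\<^esub> \<theta> (\<epsilon> (b1 \<triangleright>\<^bsub>?B\<^esub> b3) (b2 \<triangleright>\<^bsub>?B\<^esub> b3))"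
      using b by (simp only: carrier_alexander_quandle \<theta>_linear ker_\<epsilon> \<theta>_mult lookup_\<T>)
    with b b' show "laurent_T \<Z> \<odot>\<^bsub>A\<^esub> \<phi> (b1, b2) \<oplus>\<^bsub>A\<^esub> \<phi> (b1 \<triangleright>\<^bsub>?B\<^esub> b2, b3) =
        laurent_T \<Z> \<odot>\<^bsub>A\<^esub> \<phi> (b1, b3)
        \<oplus>\<^bsub>A\<^esub> (\<one>\<^bsub>\<Lambda>\<^esub> \<ominus>\<^bsub>\<Lambda>\<^esub> laurent_T \<Z>) \<odot>\<^bsub>A\<^esub> \<phi> (b2, b3)
        \<oplus>\<^bsub>A\<^esub> \<phi> (b1 \<triangleright>\<^bsub>?B\<^esub> b3, b2 \<triangleright>\<^bsub>?B\<^esub> b3)"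
      by (simp only: \<phi>)
  qed
  moreover have "alexander_quandle D \<cong>\<^sub>Q alexander_extension ?B A \<phi>"
  proof -
    define f where "f m = (let x = SOME x. \<delta> x = m in (\<theta> (x - s (\<beta> x)), \<beta> x))" for m
    have ker_s: "\<beta> (x - s (\<beta> x)) = \<beta> 0" for x
      by (intro ker_diff) (simp add: \<beta>_s)
    have f: "f (\<delta> x) = (\<theta> (x - s (\<beta> x)), \<beta> x)" for x
    proof -
      define y where "y = (SOME y. \<delta> y = \<delta> x)"
      have y: "\<delta> y = \<delta> x"
        unfolding y_def by (rule someI) simp
      then have "\<beta> y = \<beta> x"
        by (rule \<beta>_cong)
      with y show ?thesis
        by (auto simp: f_def Let_def simp flip: y_def intro!: \<theta>_cong D.cong_diff ker_diff \<beta>_s[symmetric])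
    qed
    show ?thesis
    proof (rule quandle_isomorphicI[OF D.quandle_alexander])
      show "bij_betw f (carrier (alexander_quandle D)) (carrier (alexander_extension ?B A \<phi>))"
      proof (rule bij_betw_imageI)
        show "inj_on f (carrier (alexander_quandle D))"
        proof (rule inj_onI)
          fix m n assume "m \<in> carrier (alexander_quandle D)" "n \<in> carrier (alexander_quandle D)"
            and *: "f m = f n"
          then obtain x y where xy: "m = \<delta> x" "n = \<delta> y"
            by (auto simp flip: D.surj)
          from * have \<beta>: "\<beta> x = \<beta> y" and \<theta>: "\<theta> (x - s (\<beta> x)) = \<theta> (y - s (\<beta> x))"
            by (auto simp: xy f)
          obtain a b where ab: "\<delta> (x - s (\<beta> x)) = \<delta> (r * a)" "\<theta> (x - s (\<beta> x)) = \<alpha> a"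
              "\<delta> (y - s (\<beta> x)) = \<delta> (r * b)" "\<theta> (y - s (\<beta> x)) = \<alpha> b"
            using \<theta>_E[OF ker_s[of x]] \<theta>_E[OF ker_s[of y]] \<beta> by auto
          then have "\<delta> (r * (a - b)) = \<delta> 0"
            using \<theta> A.eq_iff inj by auto
          then have "\<delta> (r * a) = \<delta> (r * b)"
            by (simp add: right_diff_distrib flip: D.eq_iff)
          with ab have "\<delta> (x - s (\<beta> x) + s (\<beta> x)) = \<delta> (y - s (\<beta> x) + s (\<beta> x))"
            by (intro D.cong_add) simp_all
          then show "m = n"
            by (simp add: xy)
        qed
        have carrier: "carrier (alexander_extension ?B A \<phi>) = carrier A \<times> carrier B"
          by (simp add: alexander_extension_def)
        have "f (\<delta> x) \<in> carrier A \<times> carrier B" for x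
          by (simp add: f \<theta>_closed)
        moreover have "c \<in> f ` range \<delta>" if "c \<in> carrier A \<times> carrier B" for c
        proof -
          from that obtain a x where c: "c = (\<alpha> a, \<beta> x)"
            by (auto simp flip: A.surj B.surj)
          have "\<beta> (r * a) = \<beta> 0"
            using ker_\<beta> by blast
          then have "\<beta> (s (\<beta> x) + r * a) = \<beta> (x + 0)"
            by (intro B.cong_add \<beta>_s)
          then have "f (\<delta> (s (\<beta> x) + r * a)) = c"
            by (simp add: c f \<theta>_eqI)
          then show ?thesis by blast
        qed
        ultimately show "f ` carrier (alexander_quandle D) = carrier (alexander_extension ?B A \<phi>)"
          unfolding carrier carrier_alexander_quandle D.surj[symmetric] by blast
      qed
      fix m n assume "m \<in> carrier (alexander_quandle D)" "n \<in> carrier (alexander_quandle D)"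
      then obtain x y where xy: "m = \<delta> x" "n = \<delta> y"
        by (auto simp flip: D.surj)
      define x' y' where "x' = x - s (\<beta> x)" and "y' = y - s (\<beta> y)"
      have ker: "\<beta> x' = \<beta> 0" "\<beta> y' = \<beta> 0"
        by (simp_all add: x'_def y'_def ker_s)
      have "x \<rhd> y - s (\<beta> (x \<rhd> y)) = \<T> * x' + (1 - \<T>) * y' + \<epsilon> (\<beta> x) (\<beta> y)"
        unfolding x'_def y'_def \<epsilon>_def B.qop_eq
        by (simp only: alexander_op_def algebra_simps mult_1_left)
      then have "\<theta> (x \<rhd> y - s (\<beta> (x \<rhd> y)))
          = (\<theta> x' \<triangleright>\<^bsub>alexander_quandle A\<^esub> \<theta> y') \<oplus>\<^bsub>A\<^esub> \<theta> (\<epsilon> (\<beta> x) (\<beta> y))"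
        by (simp only: \<theta>_add \<theta>_linear \<theta>_mult ker ker_add ker_mult ker_\<epsilon> B.closed
            alexander_quandle_def quandle.simps lookup_\<T> lookup_one_minus_\<T>)
      then show "f (m \<triangleright>\<^bsub>alexander_quandle D\<^esub> n) = f m \<triangleright>\<^bsub>alexander_extension ?B A \<phi>\<^esub> f n"
        by (simp add: xy D.qop_eq f alexander_extension_def B.qop_eq \<phi>_def flip: x'_def y'_def)
    qed
  qed
  ultimately show ?thesis by blast
qed

section \<open>The quotients of the Laurent polynomials\<close>

text \<open>The canonical map from the integral Laurent polynomials onto \<open>\<Lambda>\<^bsub>q\<^esub>/(H)\<close>.\<close>

definition quot_map :: "nat \<Rightarrow> laurent \<Rightarrow> laurent \<Rightarrow> (int \<Rightarrow> int) set"
  where "quot_map q H x = (PIdl\<^bsub>\<Lambda>\<^bsub>q\<^esub>\<^esub> reduce q H) +>\<^bsub>\<Lambda>\<^bsub>q\<^esub>\<^esub> reduce q x"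

lemma
  assumes q: "1 < q"
  shows cyclic_Lambda_quot: "cyclic_module (Lambda_quot q (reduce q H)) (quot_map q H)"
    and quot_map_eq_zero_iff: "quot_map q H x = quot_map q H 0 \<longleftrightarrow> (\<exists>b. of_nat q dvd x - b * H)"
proof -
  interpret R: cring "\<Lambda>\<^bsub>q\<^esub>" by (rule cring_Lambda_mod[OF q])
  define I where "I = PIdl\<^bsub>\<Lambda>\<^bsub>q\<^esub>\<^esub> reduce q H"
  have closed: "reduce q f \<in> carrier \<Lambda>\<^bsub>q\<^esub>" for f
    using reduce_surj[OF q] by blast
  have add: "reduce q (f + g) = reduce q f \<oplus>\<^bsub>\<Lambda>\<^bsub>q\<^esub>\<^esub> reduce q g"
    and mult: "reduce q (f * g) = reduce q f \<otimes>\<^bsub>\<Lambda>\<^bsub>q\<^esub>\<^esub> reduce q g" for f g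
    using ring_hom_add[OF reduce_hom[OF q], of f g] ring_hom_mult[OF reduce_hom[OF q], of f g]
    by (simp_all add: laurent_type_ring_def)
  have zero: "reduce q 0 = \<zero>\<^bsub>\<Lambda>\<^bsub>q\<^esub>\<^esub>"
    by (simp add: laurent_ring_def laurent_reduce_def residue_ring_def fun_eq_iff)
  interpret I: ideal I "\<Lambda>\<^bsub>q\<^esub>"
    unfolding I_def by (intro R.cgenideal_ideal closed)
  have Q: "Lambda_quot q (reduce q H) = \<lparr>carrier = a_rcosets\<^bsub>\<Lambda>\<^bsub>q\<^esub>\<^esub> I, mult = rcoset_mult \<Lambda>\<^bsub>q\<^esub> I,
      one = I +>\<^bsub>\<Lambda>\<^bsub>q\<^esub>\<^esub> \<one>\<^bsub>\<Lambda>\<^bsub>q\<^esub>\<^esub>, zero = I, add = set_add \<Lambda>\<^bsub>q\<^esub>,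
      smult = (\<lambda>c x. rcoset_mult \<Lambda>\<^bsub>q\<^esub> I (I +>\<^bsub>\<Lambda>\<^bsub>q\<^esub>\<^esub> laurent_reduce q c) x)\<rparr>"
    by (simp add: Lambda_quot_def I_def FactRing_def Let_def ring.defs module.defs)
  have map: "quot_map q H x = I +>\<^bsub>\<Lambda>\<^bsub>q\<^esub>\<^esub> reduce q x" for x
    by (simp add: quot_map_def I_def)
  show "cyclic_module (Lambda_quot q (reduce q H)) (quot_map q H)"
  proof
    have "a_rcosets\<^bsub>\<Lambda>\<^bsub>q\<^esub>\<^esub> I = (\<lambda>a. I +>\<^bsub>\<Lambda>\<^bsub>q\<^esub>\<^esub> a) ` range (reduce q)"
      unfolding reduce_surj[OF q] A_RCOSETS_def' by blast
    then show "range (quot_map q H) = carrier (Lambda_quot q (reduce q H))"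
      by (auto simp: Q map)
    show "quot_map q H 0 = \<zero>\<^bsub>Lambda_quot q (reduce q H)\<^esub>"
      using R.a_coset_add_zero[OF I.a_subset] by (simp add: Q map zero)
  qed (simp_all add: Q map add mult closed I.a_rcos_sum I.rcoset_mult_add)
  have "quot_map q H x = quot_map q H 0 \<longleftrightarrow> reduce q x \<ominus>\<^bsub>\<Lambda>\<^bsub>q\<^esub>\<^esub> reduce q 0 \<in> I"
    unfolding map by (rule R.quotient_eq_iff_same_a_r_cos[OF I.is_ideal closed closed, symmetric])
  also have "\<dots> \<longleftrightarrow> reduce q x \<in> I"
    by (simp flip: laurent_hom_diff[OF R.is_cring reduce_hom[OF q]])
  also have "\<dots> \<longleftrightarrow> (\<exists>b. reduce q x = reduce q (b * H))"
    unfolding I_def cgenideal_def reduce_surj[OF q, symmetric] by (auto simp: mult)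
  finally show "quot_map q H x = quot_map q H 0 \<longleftrightarrow> (\<exists>b. of_nat q dvd x - b * H)"
    by (simp only: reduce_eq_iff)
qed


lemma quot_map_eq_iff:
  assumes "1 < q"
  shows "quot_map q H x = quot_map q H y \<longleftrightarrow> (\<exists>b. of_nat q dvd x - y - b * H)"
  using cyclic_module.eq_iff[OF cyclic_Lambda_quot[OF assms]] quot_map_eq_zero_iff[OF assms] by metis

text \<open>Compare coefficients at the lowest exponent where \<open>b\<close> is nonzero modulo \<open>q\<close>: there only the
  constant coefficient of \<open>H\<close> contributes to the product modulo \<open>q\<close>.\<close>

lemma coprime_const_coeff_dvd_mult_cancel:
  fixes H b :: laurent
  assumes neg: "\<And>i. i < 0 \<Longrightarrow> lookup H i = 0" and const: "coprime (lookup H 0) (int q)"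
    and dvd: "of_nat q dvd H * b"
  shows "of_nat q dvd b"
proof (rule ccontr)
  define S where "S = {i. \<not> int q dvd lookup b i}"
  have S_iff: "i \<in> S \<longleftrightarrow> \<not> int q dvd lookup b i" for i
    by (simp add: S_def)
  assume "\<not> of_nat q dvd b"
  then have "S \<noteq> {}"
    by (auto simp: S_def of_nat_dvd_laurent_iff)
  moreover have "finite S"
    by (rule finite_subset[OF _ finite_keys[of b]]) (auto simp: S_def in_keys_iff)
  ultimately have Min: "Min S \<in> S"
    by (intro Min_in)
  have less_Min: "i \<notin> S" if "i < Min S" for i
    using that Min_le[OF \<open>finite S\<close>, of i] by auto
  define m where "m = Min S"
  have m: "\<not> int q dvd lookup b m" "\<And>i. i < m \<Longrightarrow> int q dvd lookup b i"
    using Min less_Min by (simp_all only: m_def S_iff simp_thms)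
  have "lookup H 0 \<noteq> 0"
    using const m(1) coprime_0_left_iff[of "int q"] unit_imp_dvd by metis
  then have "lookup (H * b) m = lookup H 0 * lookup b m
      + (\<Sum>i\<in>keys H - {0}. lookup H i * lookup b (m - i))"
    by (simp add: lookup_times_int sum.remove[of "keys H" 0] in_keys_iff)
  moreover have "int q dvd (\<Sum>i\<in>keys H - {0}. lookup H i * lookup b (m - i))"
  proof (rule dvd_sum)
    fix i assume "i \<in> keys H - {0}"
    then have "0 < i"
      using neg[of i] by (force simp: in_keys_iff)
    then show "int q dvd lookup H i * lookup b (m - i)"
      by (intro dvd_mult m(2)) simp
  qed
  moreover have "int q dvd lookup (H * b) m"
    using dvd by (simp add: of_nat_dvd_laurent_iff)
  ultimately have "int q dvd lookup H 0 * lookup b m"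
    by (simp add: dvd_add_left_iff)
  moreover have "coprime (int q) (lookup H 0)"
    using const by (simp only: coprime_commute)
  ultimately show False
    using m(1) by (simp add: coprime_dvd_mult_right_iff)
qed

text \<open>The exact sequence given by multiplication by \<open>m\<close>. The numbers \<open>m\<close> and \<open>l\<close> need not be coprime.\<close>

lemma Lambda_quot_extension:
  assumes ml: "1 < m" "1 < l"
    and H: "\<And>i. i < 0 \<Longrightarrow> lookup H i = 0" "coprime (lookup H 0) (int m)"
  defines "B \<equiv> alexander_quandle (Lambda_quot m (reduce m H))"
  shows "\<exists>\<phi>\<in>Z2_TQ B (Lambda_quot l (reduce l H)).
    alexander_quandle (Lambda_quot (m * l) (reduce (m * l) H))
      \<cong>\<^sub>Q alexander_extension B (Lambda_quot l (reduce l H)) \<phi>"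
proof -
  have q: "1 < m * l"
    using less_1_mult[OF ml] .
  note iffs = quot_map_eq_iff[OF q] quot_map_eq_iff[OF ml(1)] quot_map_eq_iff[OF ml(2)]
  show ?thesis
    unfolding B_def
  proof (rule alexander_extension_of_exact[where r = "of_nat m"])
    fix x
    show "quot_map m H x = quot_map m H 0
        \<longleftrightarrow> (\<exists>a. quot_map (m * l) H x = quot_map (m * l) H (of_nat m * a))"
    proof
      assume "quot_map m H x = quot_map m H 0"
      then obtain a b where "x - b * H = of_nat m * a"
        by (auto simp: iffs elim: dvdE)
      then have "x - of_nat m * a - b * H = 0"
        by (simp add: algebra_simps)
      then show "\<exists>a. quot_map (m * l) H x = quot_map (m * l) H (of_nat m * a)"
        by (metis dvd_0_right iffs(1))
    next
      assume "\<exists>a. quot_map (m * l) H x = quot_map (m * l) H (of_nat m * a)"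
      then obtain a b where "of_nat (m * l) dvd x - of_nat m * a - b * H"
        by (auto simp: iffs)
      then have "of_nat m dvd (x - of_nat m * a - b * H) + of_nat m * a"
        by (intro dvd_add dvd_triv_left) (auto elim: dvd_mult_left)
      then show "quot_map m H x = quot_map m H 0"
        by (auto simp: iffs)
    qed
  next
    fix a
    have cancel: "of_nat (m * l) dvd of_nat m * (a - c * H) \<longleftrightarrow> of_nat l dvd a - c * H" for c
      using ml by simp
    show "quot_map (m * l) H (of_nat m * a) = quot_map (m * l) H 0
        \<longleftrightarrow> quot_map l H a = quot_map l H 0"
    proof
      assume "quot_map (m * l) H (of_nat m * a) = quot_map (m * l) H 0"
      then obtain b where b: "of_nat (m * l) dvd of_nat m * a - b * H"
        by (auto simp: iffs)
      then have "of_nat m dvd of_nat m * a - b * H"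
        unfolding of_nat_mult by (rule dvd_mult_left)
      then have "of_nat m dvd of_nat m * a - (of_nat m * a - b * H)"
        by (rule dvd_diff[OF dvd_triv_left])
      moreover have "of_nat m * a - (of_nat m * a - b * H) = H * b"
        by (simp add: mult.commute)
      ultimately have "of_nat m dvd H * b"
        by (simp only:)
      from coprime_const_coeff_dvd_mult_cancel[OF H this] have "of_nat m dvd b" .
      then obtain c where "b = of_nat m * c" ..
      with b have "of_nat (m * l) dvd of_nat m * (a - c * H)"
        by (simp add: right_diff_distrib mult.assoc)
      then show "quot_map l H a = quot_map l H 0"
        by (auto simp: iffs cancel simp del: of_nat_mult)
    next
      assume "quot_map l H a = quot_map l H 0"
      then obtain c where "of_nat (m * l) dvd of_nat m * (a - c * H)"
        by (auto simp: iffs cancel simp del: of_nat_mult)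
      then have "of_nat (m * l) dvd of_nat m * a - 0 - (of_nat m * c) * H"
        by (simp add: right_diff_distrib mult.assoc)
      then show "quot_map (m * l) H (of_nat m * a) = quot_map (m * l) H 0"
        unfolding iffs by blast
    qed
  qed (intro cyclic_Lambda_quot q ml)+
qed

text \<open>Interpolation by integers \<open>u i\<close> that are \<open>1\<close> modulo \<open>q i\<close> and \<open>0\<close> modulo the other moduli.\<close>

lemma laurent_chinese_remainder:
  fixes q :: "'i \<Rightarrow> nat" and y :: "'i \<Rightarrow> laurent"
  assumes I: "finite I" and coprime: "\<And>i j. i \<in> I \<Longrightarrow> j \<in> I \<Longrightarrow> i \<noteq> j \<Longrightarrow> coprime (q i) (q j)"
  shows "\<exists>x. \<forall>i\<in>I. of_nat (q i) dvd x - y i"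
proof -
  have "\<forall>i. \<exists>u. \<forall>j\<in>I. [u = (if j = i then 1 else 0)] (mod q j)"
    by (intro allI chinese_remainder_nat[OF I]) (use coprime in blast)
  from choice[OF this] obtain u
    where u: "\<And>i j. j \<in> I \<Longrightarrow> [u i = (if j = i then 1 else 0)] (mod q j)"
    by blast
  have lift: "of_nat (q j) dvd (of_nat (u i) - (if j = i then 1 else 0) :: laurent)" if "j \<in> I" for i j
  proof -
    have "[int (u i) = (if j = i then 1 else 0)] (mod int (q j))"
      using u[OF that, of i] by (auto simp flip: cong_int_iff split: if_splits)
    then have "int (q j) dvd int (u i) - (if j = i then 1 else 0)"
      by (simp add: cong_iff_dvd_diff)
    then obtain t where "int (u i) - (if j = i then 1 else 0) = int (q j) * t" ..
    from arg_cong[OF this, of "of_int :: int \<Rightarrow> laurent"]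
    show ?thesis by (auto split: if_splits)
  qed
  have "of_nat (q j) dvd (\<Sum>i\<in>I. of_nat (u i) * y i) - y j" if j: "j \<in> I" for j
  proof -
    have "(\<Sum>i\<in>I. of_nat (u i) * y i) - y j
        = (of_nat (u j) - 1) * y j + (\<Sum>i\<in>I - {j}. of_nat (u i) * y i)"
      using j by (simp add: sum.remove[OF I] algebra_simps)
    moreover have "of_nat (q j) dvd (\<Sum>i\<in>I - {j}. of_nat (u i) * y i)"
    proof (rule dvd_sum)
      fix i assume "i \<in> I - {j}"
      then have "of_nat (q j) dvd (of_nat (u i) :: laurent)"
        using lift[OF j, of i] by auto
      then show "of_nat (q j) dvd of_nat (u i) * y i"
        by (rule dvd_mult2)
    qed
    ultimately show ?thesis
      using lift[OF j, of j] by (simp only: simp_thms if_True dvd_add dvd_mult2)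
  qed
  then show ?thesis by blast
qed

lemma of_nat_prod_dvd_laurent:
  fixes q :: "'i \<Rightarrow> nat" and x :: laurent
  assumes "finite I" and coprime: "\<And>i j. i \<in> I \<Longrightarrow> j \<in> I \<Longrightarrow> i \<noteq> j \<Longrightarrow> coprime (q i) (q j)"
    and "\<And>i. i \<in> I \<Longrightarrow> of_nat (q i) dvd x"
  shows "of_nat (\<Prod>i\<in>I. q i) dvd x"
proof -
  have "int (\<Prod>i\<in>I. q i) dvd lookup x k" for k
    using assms
  proof (induction I rule: finite_induct)
    case (insert a I)
    have "coprime (q a) (\<Prod>i\<in>I. q i)"
      using insert.hyps insert.prems(1) by (intro prod_coprime_right) auto
    moreover have "int (\<Prod>i\<in>I. q i) dvd lookup x k"
      by (rule insert.IH) (use insert.prems in auto)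
    moreover have "int (q a) dvd lookup x k"
      using insert.prems(2)[of a] by (simp add: of_nat_dvd_laurent_iff)
    ultimately have "int (q a) * int (\<Prod>i\<in>I. q i) dvd lookup x k"
      by (intro divides_mult) (simp_all only: coprime_int_iff)
    then show ?case
      using insert.hyps by simp
  qed auto
  then show ?thesis
    unfolding of_nat_dvd_laurent_iff by blast
qed

lemma Lambda_quot_product:
  fixes q :: "'i \<Rightarrow> nat"
  assumes I: "finite I" and coprime: "\<And>i j. i \<in> I \<Longrightarrow> j \<in> I \<Longrightarrow> i \<noteq> j \<Longrightarrow> coprime (q i) (q j)"
    and q: "\<And>i. i \<in> I \<Longrightarrow> 1 < q i" and n: "n = (\<Prod>i\<in>I. q i)" "1 < n"
  shows "alexander_quandle (Lambda_quot n (reduce n H))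
    \<cong>\<^sub>Q product_quandle I (\<lambda>i. alexander_quandle (Lambda_quot (q i) (reduce (q i) H)))"
proof (rule alexander_product)
  show "cyclic_module (Lambda_quot n (reduce n H)) (quot_map n H)"
    by (rule cyclic_Lambda_quot[OF n(2)])
  show "cyclic_module (Lambda_quot (q i) (reduce (q i) H)) (quot_map (q i) H)" if "i \<in> I" for i
    by (rule cyclic_Lambda_quot[OF q[OF that]])
  show "\<exists>x. \<forall>i\<in>I. quot_map (q i) H x = quot_map (q i) H (y i)" for y
  proof -
    have "\<exists>x. \<forall>i\<in>I. of_nat (q i) dvd x - y i"
      by (rule laurent_chinese_remainder[OF I coprime])
    then obtain x where "\<forall>i\<in>I. of_nat (q i) dvd x - y i"
      by blast
    then have "\<forall>i\<in>I. of_nat (q i) dvd x - y i - 0 * H"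
      by simp
    then show ?thesis
      using quot_map_eq_iff[OF q] by blast
  qed
  show "quot_map n H x = quot_map n H 0 \<longleftrightarrow> (\<forall>i\<in>I. quot_map (q i) H x = quot_map (q i) H 0)" for x
  proof
    assume "quot_map n H x = quot_map n H 0"
    then obtain b where "of_nat n dvd x - b * H"
      by (auto simp: quot_map_eq_zero_iff[OF n(2)])
    moreover have "of_nat (q i) dvd (of_nat n :: laurent)" if "i \<in> I" for i
      unfolding n of_nat_prod by (rule dvd_prodI[OF I that])
    ultimately show "\<forall>i\<in>I. quot_map (q i) H x = quot_map (q i) H 0"
      using quot_map_eq_zero_iff[OF q] dvd_trans by blast
  next
    assume "\<forall>i\<in>I. quot_map (q i) H x = quot_map (q i) H 0"
    then have "\<forall>i\<in>I. \<exists>b. of_nat (q i) dvd x - b * H"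
      using quot_map_eq_zero_iff[OF q] by blast
    from bchoice[OF this] obtain b where b: "\<And>i. i \<in> I \<Longrightarrow> of_nat (q i) dvd x - b i * H"
      by blast
    \<comment> \<open>One cofactor \<open>c\<close> of \<open>H\<close> serves all moduli, again by the Chinese remainder theorem.\<close>
    have "\<exists>c. \<forall>i\<in>I. of_nat (q i) dvd c - b i"
      by (rule laurent_chinese_remainder[OF I coprime])
    then obtain c where c: "\<And>i. i \<in> I \<Longrightarrow> of_nat (q i) dvd c - b i"
      by blast
    have "of_nat (q i) dvd x - c * H" if "i \<in> I" for i
    proof -
      have "x - c * H = (x - b i * H) - (c - b i) * H"
        by (simp add: algebra_simps)
      then show ?thesis
        by (simp only: dvd_diff dvd_mult2 b[OF that] c[OF that])
    qed
    then have "of_nat n dvd x - c * H"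
      unfolding n(1) by (intro of_nat_prod_dvd_laurent I coprime)
    then show "quot_map n H x = quot_map n H 0"
      unfolding quot_map_eq_zero_iff[OF n(2)] ..
  qed
qed

section \<open>Decomposition into prime powers\<close>

lemma laurent_reduce_laurent_reduce:
  "q dvd m \<Longrightarrow> laurent_reduce q (laurent_reduce m f) = laurent_reduce q f"
  by (simp add: laurent_reduce_def mod_mod_cancel)

theorem theorem5p8:
  fixes n k :: nat
    and p e :: "nat \<Rightarrow> nat"
    and h :: "int \<Rightarrow> int"
    and hj :: "nat \<Rightarrow> int \<Rightarrow> int"
  assumes "n > 0" and "k > 0"
    and "\<And>j. j \<in> {1..k} \<Longrightarrow> prime (p j)"
    and "inj_on p {1..k}"
    and "\<And>j. j \<in> {1..k} \<Longrightarrow> e j > 0"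
    and "n = (\<Prod>j\<in>{1..k}. p j ^ e j)"
    and "h \<in> laurent_polys (residue_ring (int n))"
    and "laurent_lead_coeff (residue_ring (int n)) h \<in> Units (residue_ring (int n))"
    and "h 0 \<in> Units (residue_ring (int n))"
    and "\<And>j. j \<in> {1..k} \<Longrightarrow> hj j = laurent_reduce (p j ^ e j) h"
  shows "alexander_quandle (Lambda_quot n h) \<cong>\<^sub>Q
           product_quandle {1..k} (\<lambda>j. alexander_quandle (Lambda_quot (p j ^ e j) (hj j)))
    \<and> (\<forall>j\<in>{1..k}. \<forall>d::nat. 2 \<le> d \<and> d \<le> e j \<longrightarrow>
        (let B = alexander_quandle (Lambda_quot (p j ^ (d - 1)) (laurent_reduce (p j ^ (d - 1)) (hj j)));
             A = Lambda_quot (p j) (laurent_reduce (p j) (hj j))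
         in \<exists>\<phi>\<in>Z2_TQ B A.
              alexander_quandle (Lambda_quot (p j ^ d) (laurent_reduce (p j ^ d) (hj j))) \<cong>\<^sub>Q
                alexander_extension B A \<phi>))"
proof -
  have n: "1 < n" and pn: "p j ^ e j dvd n" and pe: "1 < p j ^ e j" if "j \<in> {1..k}" for j
  proof -
    show "1 < p j ^ e j"
      using assms(3,5)[OF that] by (intro one_less_power prime_gt_1_nat)
    moreover show "p j ^ e j dvd n"
      unfolding assms(6) by (rule dvd_prodI) (use that in auto)
    ultimately show "1 < n"
      using dvd_imp_le[OF _ assms(1)] by (meson less_le_trans)
  qed
  from n[of 1] \<open>k > 0\<close> have n: "1 < n" by simp
  interpret residues "int n" "residue_ring (int n)"
    by unfold_locales (use n in auto)
  define H where "H = Abs_poly_mapping h"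
  have fin: "finite {i. h i \<noteq> 0}" and h: "h i \<in> {0..int n - 1}" "i < 0 \<Longrightarrow> h i = 0" for i
    using assms(7) by (auto simp: laurent_polys_def laurent_ring_def residue_ring_def)
  have H: "lookup H = h"
    using fin by (simp add: H_def)
  have h_eq: "h = reduce n H"
    using h(1) by (auto simp: laurent_reduce_def H fun_eq_iff)
  have coprime_h: "coprime (h 0) (int n)"
    using assms(9) by (simp add: res_units_eq)
  have hj: "hj j = reduce (p j ^ e j) H" if "j \<in> {1..k}" for j
    using assms(10)[OF that] by (simp add: H)
  have coprime_p: "coprime (p i ^ e i) (p j ^ e j)" if "i \<in> {1..k}" "j \<in> {1..k}" "i \<noteq> j" for i j
  proof -
    have "p i \<noteq> p j"
      using assms(4) that by (auto dest: inj_onD)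
    then have "coprime (p i) (p j)"
      using assms(3) that by (intro primes_coprime) auto
    then show ?thesis by simp
  qed
  have "alexander_quandle (Lambda_quot n (reduce n H)) \<cong>\<^sub>Q product_quandle {1..k}
      (\<lambda>j. alexander_quandle (Lambda_quot (p j ^ e j) (reduce (p j ^ e j) H)))"
    by (rule Lambda_quot_product) (use coprime_p pe n assms(6) in auto)
  also have "product_quandle {1..k}
      (\<lambda>j. alexander_quandle (Lambda_quot (p j ^ e j) (reduce (p j ^ e j) H)))
    = product_quandle {1..k} (\<lambda>j. alexander_quandle (Lambda_quot (p j ^ e j) (hj j)))"
    by (auto simp: product_quandle_def hj fun_eq_iff restrict_def intro!: PiE_cong)
  finally have product: "alexander_quandle (Lambda_quot n h) \<cong>\<^sub>Q
      product_quandle {1..k} (\<lambda>j. alexander_quandle (Lambda_quot (p j ^ e j) (hj j)))"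
    by (simp flip: h_eq)
  moreover have "\<exists>\<phi>\<in>Z2_TQ (alexander_quandle (Lambda_quot (p j ^ (d - 1))
          (laurent_reduce (p j ^ (d - 1)) (hj j)))) (Lambda_quot (p j) (laurent_reduce (p j) (hj j))).
      alexander_quandle (Lambda_quot (p j ^ d) (laurent_reduce (p j ^ d) (hj j))) \<cong>\<^sub>Q
      alexander_extension (alexander_quandle (Lambda_quot (p j ^ (d - 1))
          (laurent_reduce (p j ^ (d - 1)) (hj j)))) (Lambda_quot (p j) (laurent_reduce (p j) (hj j))) \<phi>"
    if j: "j \<in> {1..k}" and d: "2 \<le> d" "d \<le> e j" for j d
  proof -
    have p: "1 < p j"
      using assms(3)[OF j] by (rule prime_gt_1_nat)
    have reduce: "laurent_reduce (p j ^ c) (hj j) = reduce (p j ^ c) H" if "c \<le> e j" for c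
      unfolding hj[OF j] by (rule laurent_reduce_laurent_reduce) (use that in \<open>rule le_imp_power_dvd\<close>)
    have pd: "p j ^ (d - 1) * p j = p j ^ d"
      using d by (simp flip: power_Suc2)
    have "p j ^ (d - 1) dvd p j ^ e j"
      by (rule le_imp_power_dvd) (use d in simp)
    then have "p j ^ (d - 1) dvd n"
      using pn[OF j] by (rule dvd_trans)
    then have "coprime (lookup H 0) (int (p j ^ (d - 1)))"
      unfolding H int_dvd_int_iff[symmetric] by (rule coprime_divisors[OF dvd_refl _ coprime_h])
    moreover have "1 < p j ^ (d - 1)"
      using p d by (intro one_less_power) auto
    ultimately have extension:
      "\<exists>\<phi>\<in>Z2_TQ (alexander_quandle (Lambda_quot (p j ^ (d - 1)) (reduce (p j ^ (d - 1)) H)))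
        (Lambda_quot (p j) (reduce (p j) H)).
      alexander_quandle (Lambda_quot (p j ^ (d - 1) * p j) (reduce (p j ^ (d - 1) * p j) H)) \<cong>\<^sub>Q
      alexander_extension (alexander_quandle (Lambda_quot (p j ^ (d - 1)) (reduce (p j ^ (d - 1)) H)))
        (Lambda_quot (p j) (reduce (p j) H)) \<phi>"
      by (intro Lambda_quot_extension p) (simp_all add: H h(2))
    have le: "d - 1 \<le> e j" "1 \<le> e j"
      using d by auto
    show ?thesis
      using extension
      unfolding pd reduce[OF d(2)] reduce[OF le(1)] reduce[OF le(2), unfolded power_one_right] .
  qed
  ultimately show ?thesis
    by (simp add: Let_def)
qed

end
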